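(* Let $(\mathfrak{g},\triangleright)$ be a pre-Lie algebra, and let $\pi:\mathfrak{g}\wedge\mathfrak{g}\to\mathfrak{g}$ and $\omega:\mathfrak{g}\otimes\mathfrak{g}\to\mathfrak{g}$ be linear maps. Then $(\pi,\omega)$ is a post-Lie deformation of $(\mathfrak{g},\triangleright)$ (that is, $(\mathfrak{g},\pi,\triangleright+\omega)$ is a post-Lie algebra) if and only if $\Pi=(\pi,\omega)\in C^1_{\mathsf{PL}}(\mathfrak{g},\mathfrak{g})$ is a Maurer-Cartan element of the differential graded Lie algebra $(C^*_{\mathsf{PL}}(\mathfrak{g},\mathfrak{g}),[\cdot,\cdot]_{\mathsf{PL}},d_{\triangleright})$, i.e. $$d_{\triangleright}\Pi+\tfrac12[\Pi,\Pi]_{\mathsf{PL}}=0.$$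
   Context: All vector spaces are over a field of characteristic $0$. **Post-Lie and pre-Lie algebras.** A post-Lie algebra $(\mathfrak{g},[\cdot,\cdot],\triangleright)$ is a Lie algebra $(\mathfrak{g},[\cdot,\cdot])$ with a bilinear product $\triangleright$ such that for all $x,y,z$: $x\triangleright[y,z]=[x\triangleright y,z]+[y,x\triangleright z]$ and $([x,y]+x\triangleright y-y\triangleright x)\triangleright z=x\triangleright(y\triangleright z)-y\triangleright(x\triangleright z)$. A pre-Lie algebra $(\mathfrak{g},\triangleright)$ is a post-Lie algebra with $[\cdot,\cdot]=0$, i.e. $(x\triangleright y-y\triangleright x)\triangleright z=x\triangleright(y\triangleright z)-y\triangleright(x\triangleright z)$. **Shuffles.** $\mathbb{S}_{(i_1,\dots,i_k)}$ is the set of $(i_1,\dots,i_k)$-shuffles (permutations increasing on each of the consecutive blocks of sizes $i_1,\dots,i_k$); $(-1)^\sigma$ is the sign of $\sigma$; the set is empty if some $i_j<0$. **The graded Lie algebra.** For a vector space $V$ put $C^n_{\mathsf{PL}}(V,V)=\bigoplus_{i=0}^{n}\mathrm{Hom}(\wedge^iV\otimes\wedge^{n+1-i}V,V)$ for $n\ge 0$, and $C^*_{\mathsf{PL}}(V,V)=\bigoplus_{n\ge0}C^n_{\mathsf{PL}}(V,V)$. Write $f=(f_0,\dots,f_n)$ with $f_i\in\mathrm{Hom}(\wedge^iV\otimes\wedge^{n+1-i}V,V)$. For $f\in C^n_{\mathsf{PL}}(V,V)$, $g\in C^m_{\mathsf{PL}}(V,V)$ define $f\circ g=((f\circ g)_0,\dots,(f\circ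 g)_{n+m})\in C^{n+m}_{\mathsf{PL}}(V,V)$ as follows. For $0\le k\le m$, $$(f\circ g)_k(x_1\ldots x_k\otimes x_{k+1}\ldots x_{n+m+1})=\sum_{0\le j\le k}\ \sum_{\sigma\in\mathbb{S}_{(k-j,j)}}\ \sum_{\tau\in\mathbb{S}_{(m+1-j,n+j-k)}}(-1)^\sigma(-1)^\tau(-1)^{m(k-j)}A_{j,\sigma,\tau},$$ where $$A_{j,\sigma,\tau}=f_{k-j}\big(x_{\sigma(1)}\ldots x_{\sigma(k-j)}\otimes g_j(x_{\sigma(k-j+1)}\ldots x_{\sigma(k)}\otimes x_{k+\tau(1)}\ldots x_{k+\tau(m+1-j)})\,x_{k+\tau(m+2-j)}\ldots x_{k+\tau(n+m+1-k)}\big).$$ For $m+1\le k\le m+n$, $$(f\circ g)_k(x_1\ldots x_k\otimes x_{k+1}\ldots x_{n+m+1})=\sum_{0\le j\le m}\ \sum_{\sigma\in\mathbb{S}_{(j,m+1-j,k-m-1)}}(-1)^\sigma f_{k-m}\big(g_j(x_{\sigma(1)}\ldots x_{\sigma(j)}\otimes x_{\sigma(j+1)}\ldots x_{\sigma(m+1)})\,x_{\sigma(m+2)}\ldots x_{\sigma(k)}\otimes x_{k+1}\ldots x_{n+m+1}\big)$$ $$+\sum_{0\le j\le m}\ \sum_{\sigma\in\mathbb{S}_{(k-j,j)}}\ \sum_{\tau\in\mathbb{S}_{(m+1-j,n+j-k)}}(-1)^\sigma(-1)^\tau(-1)^{m(k-j)}A_{j,\sigma,\tau}.$$ Set $[f,g]_{\mathsf{PL}}=f\circ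 g-(-1)^{nm}g\circ f$. It is a known result (Lazarev–Sheng–Tang) that $(C^*_{\mathsf{PL}}(V,V),[\cdot,\cdot]_{\mathsf{PL}})$ is a graded Lie algebra whose Maurer-Cartan elements, i.e. $(\pi,\rho)\in C^1_{\mathsf{PL}}(V,V)=\mathrm{Hom}(\wedge^2V,V)\oplus\mathrm{Hom}(V\otimes V,V)$ with $[(\pi,\rho),(\pi,\rho)]_{\mathsf{PL}}=0$, are exactly the post-Lie algebra structures $(V,\pi,\rho)$ on $V$. **The differential.** For a pre-Lie algebra $(\mathfrak{g},\triangleright)$, regard $\triangleright$ as the element $(0,\triangleright)\in C^1_{\mathsf{PL}}(\mathfrak{g},\mathfrak{g})$; it satisfies $[\triangleright,\triangleright]_{\mathsf{PL}}=0$. Then $d_{\triangleright}(f):=[\triangleright,f]_{\mathsf{PL}}$ makes $(C^*_{\mathsf{PL}}(\mathfrak{g},\mathfrak{g}),[\cdot,\cdot]_{\mathsf{PL}},d_{\triangleright})$ a differential graded Lie algebra. *)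

theory Defs
  imports Complex_Main "HOL-Combinatorics.Permutations"
begin

section \<open>Post-Lie and pre-Lie algebras\<close>

definition bilinear_map :: "('k::field \<Rightarrow> 'v::ab_group_add \<Rightarrow> 'v) \<Rightarrow> ('v \<Rightarrow> 'v \<Rightarrow> 'v) \<Rightarrow> bool" where
  "bilinear_map scale b \<longleftrightarrow>
     (\<forall>y. Vector_Spaces.linear scale scale (\<lambda>x. b x y)) \<and>
     (\<forall>x. Vector_Spaces.linear scale scale (\<lambda>y. b x y))"

definition alternating_bilinear_map :: "('k::field \<Rightarrow> 'v::ab_group_add \<Rightarrow> 'v) \<Rightarrow> ('v \<Rightarrow> 'v \<Rightarrow> 'v) \<Rightarrow> bool" where
  "alternating_bilinear_map scale b \<longleftrightarrow> bilinear_map scale b \<and> (\<forall>x. b x x = 0)"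

locale lie_algebra = vector_space scale
  for scale :: "'k::field_char_0 \<Rightarrow> 'v::ab_group_add \<Rightarrow> 'v" +
  fixes br :: "'v \<Rightarrow> 'v \<Rightarrow> 'v"
  assumes br_alternating_bilinear: "alternating_bilinear_map scale br"
    and jacobi: "br x (br y z) + br y (br z x) + br z (br x y) = 0"

locale post_lie_algebra = lie_algebra scale br
  for scale :: "'k::field_char_0 \<Rightarrow> 'v::ab_group_add \<Rightarrow> 'v" and br +
  fixes tri :: "'v \<Rightarrow> 'v \<Rightarrow> 'v"
  assumes tri_bilinear: "bilinear_map scale tri"
    and tri_derivation: "tri x (br y z) = br (tri x y) z + br y (tri x z)"
    and tri_associator:
      "tri (br x y + tri x y - tri y x) z = tri x (tri y z) - tri y (tri x z)"

definition pre_lie_algebra :: "('k::field_char_0 \<Rightarrow> 'v::ab_group_add \<Rightarrow> 'v) \<Rightarrow> ('v \<Rightarrow> 'v \<Rightarrow> 'v) \<Rightarrow> bool" where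
  "pre_lie_algebra scale tri \<longleftrightarrow> post_lie_algebra scale (\<lambda>_ _. 0) tri"

definition post_lie_deformation ::
  "('k::field_char_0 \<Rightarrow> 'v::ab_group_add \<Rightarrow> 'v) \<Rightarrow> ('v \<Rightarrow> 'v \<Rightarrow> 'v) \<Rightarrow>
   ('v \<Rightarrow> 'v \<Rightarrow> 'v) \<Rightarrow> ('v \<Rightarrow> 'v \<Rightarrow> 'v) \<Rightarrow> bool" where
  "post_lie_deformation scale tri \<pi> \<omega> \<longleftrightarrow>
     post_lie_algebra scale \<pi> (\<lambda>x y. tri x y + \<omega> x y)"


section \<open>Shuffles\<close>

text \<open>Shuffles permute the 0-based index set \<open>{..<i\<^sub>1 + \<dots> + i\<^sub>k}\<close>. The block sizes are integers
  because the composition below uses differences that may be negative, in which case there are no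
  shuffles.\<close>

definition block_shuffles :: "int list \<Rightarrow> (nat \<Rightarrow> nat) set" where
  "block_shuffles is =
     (if \<exists>i\<in>set is. i < 0 then {}
      else {\<sigma>. \<sigma> permutes {..<nat (sum_list is)} \<and>
               (\<forall>j<length is.
                  strict_mono_on {nat (sum_list (take j is))..<nat (sum_list (take (Suc j) is))} \<sigma>)})"


section \<open>The graded Lie algebra of post-Lie cochains\<close>

text \<open>A cochain \<open>f = (f\<^sub>0, \<dots>, f\<^sub>n)\<close> of degree \<open>n\<close> is represented by the function
  \<open>\<lambda>i xs ys. f\<^sub>i(xs \<otimes> ys)\<close>; the linear map \<open>f\<^sub>i\<close> on \<open>\<wedge>\<^sup>iV \<otimes> \<wedge>\<^sup>n\<^sup>+\<^sup>1\<^sup>-\<^sup>iV\<close> is given by its multilinear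
  form in \<open>i\<close> arguments \<open>xs\<close> and \<open>n + 1 - i\<close> arguments \<open>ys\<close>, alternating in each of the two groups.
  Outside of these arities the function is 0, so that equality of functions is equality of cochains.\<close>

type_synonym 'v cochain = "nat \<Rightarrow> 'v list \<Rightarrow> 'v list \<Rightarrow> 'v"

definition PL_cochains :: "('k::field \<Rightarrow> 'v::ab_group_add \<Rightarrow> 'v) \<Rightarrow> nat \<Rightarrow> 'v cochain set" where
  "PL_cochains scale n =
     {f. (\<forall>i xs ys. \<not> (i \<le> n \<and> length xs = i \<and> length ys = n + 1 - i) \<longrightarrow> f i xs ys = 0) \<and>
         (\<forall>i\<le>n. \<forall>xs ys. length xs = i \<longrightarrow> length ys = n + 1 - i \<longrightarrow>
            (\<forall>p<length xs. Vector_Spaces.linear scale scale (\<lambda>v. f i (xs[p := v]) ys)) \<and>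
            (\<forall>p<length ys. Vector_Spaces.linear scale scale (\<lambda>v. f i xs (ys[p := v]))) \<and>
            (\<not> distinct xs \<longrightarrow> f i xs ys = 0) \<and>
            (\<not> distinct ys \<longrightarrow> f i xs ys = 0))}"

text \<open>In \<open>PL_insert_right\<close>, \<open>PL_insert_left\<close> and \<open>PL_circ\<close>, the cochains \<open>f\<close> and \<open>g\<close> have degrees
  \<open>n\<close> and \<open>m\<close>, and \<open>xs = x\<^sub>1, \<dots>, x\<^sub>k\<close> and \<open>ys = x\<^sub>k\<^sub>+\<^sub>1, \<dots>, x\<^sub>n\<^sub>+\<^sub>m\<^sub>+\<^sub>1\<close>. The first is the summand
  with index \<open>j\<close> occurring in both cases of the composition, where \<open>g\<^sub>j\<close> is inserted after the tensor
  sign; the second is the one occurring only for \<open>k > m\<close>, where it is inserted before.\<close>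

definition PL_insert_right ::
  "('k::field \<Rightarrow> 'v::ab_group_add \<Rightarrow> 'v) \<Rightarrow> nat \<Rightarrow> nat \<Rightarrow> 'v cochain \<Rightarrow> 'v cochain \<Rightarrow>
   nat \<Rightarrow> nat \<Rightarrow> 'v list \<Rightarrow> 'v list \<Rightarrow> 'v" where
  "PL_insert_right scale n m f g k j xs ys =
     (\<Sum>\<sigma>\<in>block_shuffles [int k - int j, int j].
      \<Sum>\<tau>\<in>block_shuffles [int m + 1 - int j, int n + int j - int k].
        scale (of_int (sign \<sigma>) * of_int (sign \<tau>) * (-1) ^ (m * (k - j)))
          (f (k - j)
             (map (\<lambda>i. xs ! \<sigma> i) [0..<k - j])
             (g j (map (\<lambda>i. xs ! \<sigma> i) [k - j..<k]) (map (\<lambda>i. ys ! \<tau> i) [0..<m + 1 - j])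
              # map (\<lambda>i. ys ! \<tau> i) [m + 1 - j..<n + m + 1 - k])))"

definition PL_insert_left ::
  "('k::field \<Rightarrow> 'v::ab_group_add \<Rightarrow> 'v) \<Rightarrow> nat \<Rightarrow> nat \<Rightarrow> 'v cochain \<Rightarrow> 'v cochain \<Rightarrow>
   nat \<Rightarrow> nat \<Rightarrow> 'v list \<Rightarrow> 'v list \<Rightarrow> 'v" where
  "PL_insert_left scale n m f g k j xs ys =
     (\<Sum>\<sigma>\<in>block_shuffles [int j, int m + 1 - int j, int k - int m - 1].
        scale (of_int (sign \<sigma>))
          (f (k - m)
             (g j (map (\<lambda>i. xs ! \<sigma> i) [0..<j]) (map (\<lambda>i. xs ! \<sigma> i) [j..<m + 1])
              # map (\<lambda>i. xs ! \<sigma> i) [m + 1..<k])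
             ys))"

definition PL_circ ::
  "('k::field \<Rightarrow> 'v::ab_group_add \<Rightarrow> 'v) \<Rightarrow> nat \<Rightarrow> nat \<Rightarrow> 'v cochain \<Rightarrow> 'v cochain \<Rightarrow> 'v cochain" where
  "PL_circ scale n m f g k xs ys =
     (if k \<le> n + m \<and> length xs = k \<and> length ys = n + m + 1 - k then
        if k \<le> m then (\<Sum>j\<le>k. PL_insert_right scale n m f g k j xs ys)
        else (\<Sum>j\<le>m. PL_insert_left scale n m f g k j xs ys)
           + (\<Sum>j\<le>m. PL_insert_right scale n m f g k j xs ys)
      else 0)"

text \<open>The graded operations are given by their homogeneous components, here
  \<open>C\<^sup>n \<times> C\<^sup>m \<rightarrow> C\<^sup>n\<^sup>+\<^sup>m\<close> and below \<open>C\<^sup>n \<rightarrow> C\<^sup>n\<^sup>+\<^sup>1\<close>.\<close>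

definition PL_bracket ::
  "('k::field \<Rightarrow> 'v::ab_group_add \<Rightarrow> 'v) \<Rightarrow> nat \<Rightarrow> nat \<Rightarrow> 'v cochain \<Rightarrow> 'v cochain \<Rightarrow> 'v cochain" where
  "PL_bracket scale n m f g =
     (\<lambda>k xs ys. PL_circ scale n m f g k xs ys
        - scale ((-1) ^ (n * m)) (PL_circ scale m n g f k xs ys))"

text \<open>The element \<open>(\<pi>, \<rho>)\<close> of \<open>Hom(\<wedge>\<^sup>2V, V) \<oplus> Hom(V \<otimes> V, V) = C\<^sup>1\<close>.\<close>

definition PL_pair :: "('v::zero \<Rightarrow> 'v \<Rightarrow> 'v) \<Rightarrow> ('v \<Rightarrow> 'v \<Rightarrow> 'v) \<Rightarrow> 'v cochain" where
  "PL_pair \<pi> \<rho> i xs ys =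
     (if i = 0 \<and> length xs = 0 \<and> length ys = 2 then \<pi> (ys ! 0) (ys ! 1)
      else if i = 1 \<and> length xs = 1 \<and> length ys = 1 then \<rho> (xs ! 0) (ys ! 0)
      else 0)"

definition PL_differential ::
  "('k::field \<Rightarrow> 'v::ab_group_add \<Rightarrow> 'v) \<Rightarrow> ('v \<Rightarrow> 'v \<Rightarrow> 'v) \<Rightarrow> nat \<Rightarrow> 'v cochain \<Rightarrow> 'v cochain" where
  "PL_differential scale tri n f = PL_bracket scale 1 n (PL_pair (\<lambda>_ _. 0) tri) f"

definition PL_maurer_cartan ::
  "('k::field \<Rightarrow> 'v::ab_group_add \<Rightarrow> 'v) \<Rightarrow> ('v \<Rightarrow> 'v \<Rightarrow> 'v) \<Rightarrow> 'v cochain \<Rightarrow> bool" where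
  "PL_maurer_cartan scale tri P \<longleftrightarrow>
     P \<in> PL_cochains scale 1 \<and>
     (\<lambda>k xs ys. PL_differential scale tri 1 P k xs ys
        + scale (1 / 2) (PL_bracket scale 1 1 P P k xs ys)) = (\<lambda>_ _ _. 0)"

end

theory Submission
  imports Defs
begin

text \<open>Since both \<open>\<Pi> = (\<pi>, \<omega>)\<close> and \<open>T = (0, \<triangleright>)\<close> have degree 1, the Maurer-Cartan expression is
  \<open>T \<circ> \<Pi> + \<Pi> \<circ> T + \<Pi> \<circ> \<Pi>\<close>. Its components of index 0, 1, 2 are, up to sign, the defects of the
  Jacobi identity, of the derivation rule and of the associator identity for \<open>(\<pi>, \<triangleright> + \<omega>)\<close>; in
  index 2 the missing summand \<open>T \<circ> T\<close> vanishes because \<open>\<triangleright>\<close> is pre-Lie.\<close>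

section \<open>Small shuffles\<close>

lemma permutes_lessThan_1: "\<sigma> permutes {..<Suc 0} \<longleftrightarrow> \<sigma> = id"
  by (simp add: lessThan_Suc)

lemma permutes_lessThan_2:
  "\<sigma> permutes {..<2::nat} \<longleftrightarrow> \<sigma> = id \<or> \<sigma> = transpose 0 1" (is "?P \<longleftrightarrow> ?Q")
proof
  assume P: ?P
  have ran: "\<sigma> 0 < 2" "\<sigma> 1 < 2" and ne: "\<sigma> 0 \<noteq> \<sigma> 1"
    using permutes_in_image[OF P, of 0] permutes_in_image[OF P, of 1] inj_eq[OF permutes_inj[OF P], of 0 1]
    by auto
  have fixed: "\<sigma> i = i" if "i \<noteq> 0" "i \<noteq> 1" for i
    using permutes_not_in[OF P, of i] that by auto
  consider "\<sigma> 0 = 0" "\<sigma> 1 = 1" | "\<sigma> 0 = 1" "\<sigma> 1 = 0"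
    using ran ne by linarith
  then show ?Q
  proof cases
    case 1
    then have "\<sigma> = id" using fixed by (metis eq_id_iff)
    then show ?thesis ..
  next
    case 2
    then have "\<sigma> = transpose 0 1"
      using fixed by (auto simp: fun_eq_iff transpose_def)
    then show ?thesis ..
  qed
next
  assume ?Q
  then show ?P
    by (auto simp: permutes_id intro: permutes_swap_id)
qed

lemma block_shuffles_0_0: "block_shuffles [0, 0] = {id}"
  by (auto simp: block_shuffles_def strict_mono_on_def)

lemma block_shuffles_1_0: "block_shuffles [1, 0] = {id}"
  and block_shuffles_0_1: "block_shuffles [0, 1] = {id}"
  by (auto simp: block_shuffles_def strict_mono_on_def permutes_lessThan_1 less_Suc_eq)

lemma strict_mono_on_2: "strict_mono_on {0..<2::nat} \<sigma> \<longleftrightarrow> \<sigma> 0 < (\<sigma> 1 :: nat)"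
  by (auto simp: strict_mono_on_def less_Suc_eq numeral_2_eq_2)

lemma block_shuffles_2_0: "block_shuffles [2, 0] = {id}"
  and block_shuffles_0_2_0: "block_shuffles [0, 2, 0] = {id}"
  by (auto simp: block_shuffles_def strict_mono_on_2 permutes_lessThan_2 less_Suc_eq)

lemma block_shuffles_1_1: "block_shuffles [1, 1] = {id, transpose 0 1}"
  and block_shuffles_1_1_0: "block_shuffles [1, 1, 0] = {id, transpose 0 1}"
  by (auto simp: block_shuffles_def strict_mono_on_def permutes_lessThan_2 less_Suc_eq)

text \<open>A (2,1)-shuffle is determined by the value at the last index; the values 2, 1, 0 give
  the three listed permutations in this order.\<close>

lemma block_shuffles_2_1:
  "block_shuffles [2, 1] = {id, transpose 1 2, transpose 0 1 \<circ> transpose 1 2}" (is "?L = ?R")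
proof
  \<comment> \<open>The second block is a single index, so only the first block constrains
    \<sigma>.\<close>
  have char: "\<sigma> \<in> ?L \<longleftrightarrow> \<sigma> permutes {..<3} \<and> \<sigma> 0 < \<sigma> 1" for \<sigma>
    by (auto simp: block_shuffles_def strict_mono_on_def less_Suc_eq numeral_2_eq_2 numeral_3_eq_3)
  show "?L \<subseteq> ?R"
  proof
    fix \<sigma> assume "\<sigma> \<in> ?L"
    then have P: "\<sigma> permutes {..<3}" and lt: "\<sigma> 0 < \<sigma> 1"
      by (auto simp: char)
    have ran: "\<sigma> 0 < 3" "\<sigma> 1 < 3" "\<sigma> 2 < 3"
      using permutes_in_image[OF P, of 0] permutes_in_image[OF P, of 1] permutes_in_image[OF P, of 2]
      by auto
    have ne: "\<sigma> 0 \<noteq> \<sigma> 2" "\<sigma> 1 \<noteq> \<sigma> 2"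
      by (simp_all add: inj_eq[OF permutes_inj[OF P]])
    have fixed: "\<sigma> i = i" if "i \<noteq> 0" "i \<noteq> 1" "i \<noteq> 2" for i
      using permutes_not_in[OF P, of i] that by auto
    consider "\<sigma> 0 = 0" "\<sigma> 1 = 1" "\<sigma> 2 = 2" | "\<sigma> 0 = 0" "\<sigma> 1 = 2" "\<sigma> 2 = 1"
      | "\<sigma> 0 = 1" "\<sigma> 1 = 2" "\<sigma> 2 = 0"
      using ran ne lt by linarith
    then show "\<sigma> \<in> ?R"
    proof cases
      case 1
      then have "\<sigma> = id" using fixed by (metis eq_id_iff)
      then show ?thesis by simp
    next
      case 2
      then have "\<sigma> = transpose 1 2"
        using fixed by (auto simp: fun_eq_iff transpose_def) (metis not_gr0)
      then show ?thesis by simp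
    next
      case 3
      then have "\<sigma> = transpose 0 1 \<circ> transpose 1 2"
        using fixed by (auto simp: fun_eq_iff transpose_def)
      then show ?thesis by simp
    qed
  qed
  have "transpose (0::nat) 1 permutes {..<3}" "transpose (1::nat) 2 permutes {..<3}"
    by (auto intro: permutes_swap_id)
  then show "?R \<subseteq> ?L"
    by (auto simp: char permutes_id permutes_compose)
qed

text \<open>Needed for k = 2, j = 0 in degree 1: the second block of \<tau> would have size -1,
  reflecting that a degree 1 cochain has no component of index 2.\<close>

lemma block_shuffles_neg: "i < 0 \<Longrightarrow> block_shuffles [j, i] = {}"
  by (simp add: block_shuffles_def)

lemmas small_shuffles = block_shuffles_0_0 block_shuffles_1_0 block_shuffles_0_1
  block_shuffles_2_0 block_shuffles_0_2_0 block_shuffles_1_1 block_shuffles_1_1_0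
  block_shuffles_neg


section \<open>Composition in degree 1\<close>

lemma PL_pair_0 [simp]: "PL_pair \<pi> \<rho> 0 [] [x, y] = \<pi> x y"
  and PL_pair_1 [simp]: "PL_pair \<pi> \<rho> (Suc 0) [x] [y] = \<rho> x y"
  by (simp_all add: PL_pair_def)

text \<open>Turning a sum over an enumerated set of shuffles into one term per shuffle requires that
  they be distinct.\<close>

lemma sum_id_transpose:
  assumes "a \<noteq> b"
  shows "sum f {id, transpose a b} = f id + f (transpose a b)"
proof -
  have "id \<noteq> transpose a b" using assms by (metis id_apply transpose_apply_first)
  then show ?thesis by simp
qed

lemma sum_block_shuffles_2_1:
  "sum f (block_shuffles [2, 1]) = f id + f (transpose 1 2) + f (transpose 0 1 \<circ> transpose 1 2)"
proof -
  let ?c = "transpose (0::nat) 1 \<circ> transpose 1 2"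
  have "id \<noteq> transpose (1::nat) 2"
    by (auto simp: transpose_def dest: fun_cong[of _ _ 1])
  moreover have "id \<noteq> ?c" "transpose 1 2 \<noteq> ?c"
    by (auto simp: transpose_def dest!: fun_cong[of _ _ 0])
  ultimately show ?thesis by (simp add: block_shuffles_2_1 add.assoc)
qed

lemma sign_three_cycle: "sign (transpose (0::nat) 1 \<circ> transpose 1 2) = 1"
  by (simp add: sign_compose permutation_swap_id sign_swap_id)

text \<open>The sign of the three-cycle is restated with \<open>Suc\<close> because the computations
  below unfold 2 to \<open>Suc (Suc 0)\<close>. \<open>transpose_def\<close> rewrites only applied
  transpositions, so those under \<open>sign\<close> remain available to
  \<open>sign_swap_id\<close>.\<close>

lemmas circ_simps = PL_circ_def PL_insert_right_def PL_insert_left_def sum_block_shuffles_2_1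
  small_shuffles sum_id_transpose sign_three_cycle[unfolded numeral_2_eq_2 One_nat_def]
  sign_swap_id transpose_def[of _ _ "_::nat"]

context vector_space
begin

text \<open>One term for each (2,1)-shuffle of the three arguments, with its sign.\<close>

lemma PL_circ_pair_0:
  "PL_circ scale 1 1 (PL_pair a r) (PL_pair b s) 0 [] [x, y, z] =
     a (b x y) z - a (b x z) y + a (b y z) x"
  by (simp add: circ_simps upt_rec numeral_2_eq_2)

text \<open>The first two terms are the (1,1)-shuffles for j = 1. The last is j = 0, with sign
  (-1)^(m(k-j)) = -1.\<close>

lemma PL_circ_pair_1:
  "PL_circ scale 1 1 (PL_pair a r) (PL_pair b s) 1 [x] [y, z] =
     a (s x y) z - a (s x z) y - r x (b y z)"
  by (simp add: circ_simps upt_rec numeral_2_eq_2)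

text \<open>The first three terms come from insertion before the tensor sign (j = 0, then j = 1),
  the last two from insertion after it with j = 1.\<close>

lemma PL_circ_pair_2:
  "PL_circ scale 1 1 (PL_pair a r) (PL_pair b s) 2 [x, y] [z] =
     r (b x y) z + r (s x y) z - r (s y x) z - r x (s y z) + r y (s x z)"
  by (simp add: circ_simps upt_rec numeral_2_eq_2)


text \<open>For n = m = 1 the sign (-1)^(nm) is -1, so the bracket is the symmetrized composition
  and [P,P] is twice \<open>P \<circ> P\<close>; the factor 1/2 cancels this. The locale allows any
  field, hence the condition on 2.\<close>

lemma PL_maurer_cartan_deg1:
  assumes char: "(2::'a) \<noteq> 0"
  shows "PL_maurer_cartan scale tri P \<longleftrightarrow> P \<in> PL_cochains scale 1 \<and>
    (\<forall>k xs ys. PL_circ scale 1 1 (PL_pair (\<lambda>_ _. 0) tri) P k xs ys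
       + PL_circ scale 1 1 P (PL_pair (\<lambda>_ _. 0) tri) k xs ys
       + PL_circ scale 1 1 P P k xs ys = 0)"
proof -
  have half: "scale (1 / 2) (v + v) = v" for v
  proof -
    have "scale (1 / 2) (v + v) = scale (1 / 2 + 1 / 2) v"
      by (simp only: scale_left_distrib scale_right_distrib)
    also have "(1 / 2 + 1 / 2 :: 'a) = 1"
      using char by (simp add: field_simps)
    finally show ?thesis by simp
  qed
  show ?thesis
    by (simp add: PL_maurer_cartan_def PL_differential_def PL_bracket_def fun_eq_iff half)
qed

end

section \<open>Reduction to the three arities of a degree 2 cochain\<close>

lemma PL_circ_deg1_eq_0:
  assumes "\<not> (k = 0 \<and> length xs = 0 \<and> length ys = 3)"
    and "\<not> (k = 1 \<and> length xs = 1 \<and> length ys = 2)"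
    and "\<not> (k = 2 \<and> length xs = 2 \<and> length ys = 1)"
  shows "PL_circ scale 1 1 f g k xs ys = 0"
proof -
  have "\<not> (k \<le> 1 + 1 \<and> length xs = k \<and> length ys = 1 + 1 + 1 - k)"
    using assms by presburger
  then show ?thesis
    unfolding PL_circ_def by (rule if_not_P)
qed

text \<open>Cochains are total functions, so the Maurer-Cartan equation also ranges over lists of
  the wrong lengths, where composites are 0 by convention.\<close>

lemma all_PL_components:
  fixes E :: "'v::zero cochain"
  assumes "\<And>k xs ys. \<not> (k = 0 \<and> length xs = 0 \<and> length ys = 3) \<Longrightarrow>
      \<not> (k = 1 \<and> length xs = 1 \<and> length ys = 2) \<Longrightarrow>
      \<not> (k = 2 \<and> length xs = 2 \<and> length ys = 1) \<Longrightarrow> E k xs ys = 0"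
  shows "(\<forall>k xs ys. E k xs ys = 0) \<longleftrightarrow>
    (\<forall>x y z. E 0 [] [x, y, z] = 0) \<and> (\<forall>x y z. E 1 [x] [y, z] = 0) \<and>
    (\<forall>x y z. E 2 [x, y] [z] = 0)" (is "?L \<longleftrightarrow> ?R")
proof
  assume R: ?R
  show ?L
  proof (intro allI)
    fix k :: nat and xs ys :: "'v list"
    consider "k = 0" "length xs = 0" "length ys = 3" | "k = 1" "length xs = 1" "length ys = 2"
      | "k = 2" "length xs = 2" "length ys = 1"
      | "\<not> (k = 0 \<and> length xs = 0 \<and> length ys = 3)"
        "\<not> (k = 1 \<and> length xs = 1 \<and> length ys = 2)"
        "\<not> (k = 2 \<and> length xs = 2 \<and> length ys = 1)"
      by blast
    then show "E k xs ys = 0"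
    proof cases
      case 1
      then obtain x y z where "xs = []" "ys = [x, y, z]"
        by (auto simp: numeral_3_eq_3 length_Suc_conv)
      with 1 R show ?thesis by simp
    next
      case 2
      then obtain x y z where "xs = [x]" "ys = [y, z]"
        by (auto simp: numeral_2_eq_2 length_Suc_conv)
      with 2 R show ?thesis by simp
    next
      case 3
      then obtain x y z where "xs = [x, y]" "ys = [z]"
        by (auto simp: numeral_2_eq_2 length_Suc_conv)
      with 3 R show ?thesis by simp
    qed (rule assms)
  qed
qed simp

section \<open>Bilinear maps and degree 1 cochains\<close>

lemma bilinear_map_linear:
  assumes "bilinear_map scale b"
  shows "Vector_Spaces.linear scale scale (\<lambda>x. b x y)" "Vector_Spaces.linear scale scale (b x)"
  using assms by (auto simp: bilinear_map_def)

lemma bilinear_map_simps: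
  fixes scale :: "'k::field \<Rightarrow> 'v::ab_group_add \<Rightarrow> 'v"
  assumes "bilinear_map scale b"
  shows "b (x + x') y = b x y + b x' y" "b x (y + y') = b x y + b x y'"
    and "b (x - x') y = b x y - b x' y" "b x (y - y') = b x y - b x y'"
    and "b (- x) y = - b x y" "b x (- y) = - b x y"
    and "b 0 y = 0" "b x 0 = 0"
proof -
  interpret l: Vector_Spaces.linear scale scale "\<lambda>x. b x y"
    by (rule bilinear_map_linear[OF assms])
  interpret r: Vector_Spaces.linear scale scale "b x"
    by (rule bilinear_map_linear[OF assms])
  show "b (x + x') y = b x y + b x' y" "b x (y + y') = b x y + b x y'"
    "b (x - x') y = b x y - b x' y" "b x (y - y') = b x y - b x y'"
    "b (- x) y = - b x y" "b x (- y) = - b x y" "b 0 y = 0" "b x 0 = 0"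
    by (fact l.add r.add l.diff r.diff l.neg r.neg l.zero r.zero)+
qed

lemma alternating_bilinear_map_swap:
  assumes "alternating_bilinear_map scale b"
  shows "b x y = - b y x"
proof -
  have B: "bilinear_map scale b" and A: "\<And>x. b x x = 0"
    using assms by (auto simp: alternating_bilinear_map_def)
  have "0 = b (x + y) (x + y)" by (simp add: A)
  also have "\<dots> = b x y + b y x" by (simp only: bilinear_map_simps[OF B]) (simp add: A)
  finally show ?thesis by (simp add: eq_neg_iff_add_eq_0)
qed

lemma bilinear_map_add:
  assumes "bilinear_map scale b" "bilinear_map scale c"
  shows "bilinear_map scale (\<lambda>x y. b x y + c x y)"
proof -
  have "vector_space_pair scale scale"
    using assms(1) by (auto simp: bilinear_map_def Vector_Spaces.linear_def vector_space_pair_def)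
  then show ?thesis
    using assms by (simp add: bilinear_map_def vector_space_pair.linear_compose_add)
qed

text \<open>Alternation matters only for the two arguments of the index 0 component; in index 1 each
  group has a single argument.\<close>

lemma PL_pair_in_PL_cochains:
  assumes "alternating_bilinear_map scale \<pi>" "bilinear_map scale \<rho>"
  shows "PL_pair \<pi> \<rho> \<in> PL_cochains scale 1"
proof -
  have "bilinear_map scale \<pi>" and A: "\<And>x. \<pi> x x = 0"
    using assms by (auto simp: alternating_bilinear_map_def)
  note lin = bilinear_map_linear[OF this(1)] bilinear_map_linear[OF assms(2)]
  show ?thesis
    unfolding PL_cochains_def
    by (auto simp: PL_pair_def le_Suc_eq numeral_2_eq_2 length_Suc_conv less_Suc_eq A lin)
qed

section \<open>Componentwise comparison with the post-Lie identities\<close>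

lemma post_lie_algebra_iff:
  assumes "alternating_bilinear_map scale br" "bilinear_map scale t"
  shows "post_lie_algebra scale br t \<longleftrightarrow>
    (\<forall>x y z. br x (br y z) + br y (br z x) + br z (br x y) = 0) \<and>
    (\<forall>x y z. t x (br y z) = br (t x y) z + br y (t x z)) \<and>
    (\<forall>x y z. t (br x y + t x y - t y x) z = t x (t y z) - t y (t x z))"
proof -
  have "vector_space scale"
    using assms(2) by (auto simp: bilinear_map_def Vector_Spaces.linear_def)
  with assms show ?thesis
    by (auto simp: post_lie_algebra_def post_lie_algebra_axioms_def lie_algebra_def
        lie_algebra_axioms_def)
qed

theorem theorem2p6:
  fixes scale :: "'k::field_char_0 \<Rightarrow> 'v::ab_group_add \<Rightarrow> 'v"
    and tri \<pi> \<omega> :: "'v \<Rightarrow> 'v \<Rightarrow> 'v"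
  assumes "pre_lie_algebra scale tri"
    and "alternating_bilinear_map scale \<pi>"
    and "bilinear_map scale \<omega>"
  shows "post_lie_deformation scale tri \<pi> \<omega> \<longleftrightarrow> PL_maurer_cartan scale tri (PL_pair \<pi> \<omega>)"
proof -
  interpret T: post_lie_algebra scale "\<lambda>_ _. 0" tri
    using assms(1) by (simp add: pre_lie_algebra_def)
  have bp: "bilinear_map scale \<pi>"
    using assms(2) by (simp add: alternating_bilinear_map_def)
  note bil = bilinear_map_simps[OF bp] bilinear_map_simps[OF assms(3)]
    bilinear_map_simps[OF T.tri_bilinear]
  note swap = alternating_bilinear_map_swap[OF assms(2)]
  define T P where "T = PL_pair (\<lambda>_ _. 0) tri" and "P = PL_pair \<pi> \<omega>"
  define E where "E k xs ys = PL_circ scale 1 1 T P k xs ys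
    + PL_circ scale 1 1 P T k xs ys + PL_circ scale 1 1 P P k xs ys" for k xs ys
  have mc: "PL_maurer_cartan scale tri P \<longleftrightarrow>
    (\<forall>x y z. E 0 [] [x, y, z] = 0) \<and> (\<forall>x y z. E 1 [x] [y, z] = 0) \<and>
    (\<forall>x y z. E 2 [x, y] [z] = 0)"
  proof -
    have "PL_maurer_cartan scale tri P \<longleftrightarrow> (\<forall>k xs ys. E k xs ys = 0)"
      using PL_pair_in_PL_cochains[OF assms(2,3)]
      by (simp add: T.PL_maurer_cartan_deg1 E_def T_def P_def)
    also have "\<dots> \<longleftrightarrow> (\<forall>x y z. E 0 [] [x, y, z] = 0) \<and> (\<forall>x y z. E 1 [x] [y, z] = 0) \<and>
        (\<forall>x y z. E 2 [x, y] [z] = 0)"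
      by (rule all_PL_components) (simp only: E_def PL_circ_deg1_eq_0 not_False_eq_True add_0_left)
    finally show ?thesis .
  qed
  let ?t = "\<lambda>x y. tri x y + \<omega> x y"
  \<comment> \<open>Only \<open>P \<circ> P\<close> contributes, since T has zero index 0 component.
    Skew-symmetry turns the three shuffle terms into the cyclic Jacobi sum.\<close>
  have E0: "E 0 [] [x, y, z] = - (\<pi> x (\<pi> y z) + \<pi> y (\<pi> z x) + \<pi> z (\<pi> x y))" for x y z
    unfolding E_def T_def P_def T.PL_circ_pair_0
    using swap[of "\<pi> x y" z] swap[of "\<pi> x z" y] swap[of "\<pi> y z" x] swap[of x z]
    by (simp add: bil algebra_simps)
  \<comment> \<open>\<open>T \<circ> P\<close> supplies \<open>tri x (\<pi> y z)\<close>,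
    \<open>P \<circ> T\<close> the brackets containing \<open>tri\<close>, and
    \<open>P \<circ> P\<close> all terms with \<omega>.\<close>
  have E1: "E 1 [x] [y, z] = - (?t x (\<pi> y z) - (\<pi> (?t x y) z + \<pi> y (?t x z)))" for x y z
    unfolding E_def T_def P_def T.PL_circ_pair_1
    using swap[of "tri x z" y] swap[of "\<omega> x z" y]
    by (simp add: bil algebra_simps)
  \<comment> \<open>Expanding the right side gives all of E plus the terms with \<open>tri\<close>
    twice; the latter cancel by \<open>T.tri_associator\<close>, whose bracket is 0.\<close>
  have E2: "E 2 [x, y] [z] = ?t (\<pi> x y + ?t x y - ?t y x) z - (?t x (?t y z) - ?t y (?t x z))"
    for x y z
    unfolding E_def T_def P_def T.PL_circ_pair_2
    using T.tri_associator[of x y z]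
    by (simp add: bil algebra_simps)
  show ?thesis
    unfolding post_lie_deformation_def mc[unfolded P_def] E0 E1 E2
      post_lie_algebra_iff[OF assms(2) bilinear_map_add[OF T.tri_bilinear assms(3)]]
    \<comment> \<open>The minus signs in \<open>E0\<close> and \<open>E1\<close> do not affect
      vanishing, and a vanishing difference is an equality.\<close>
    by (simp only: neg_equal_0_iff_equal right_minus_eq)
qed

end
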